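(* Let $(X,\mathcal{A},d)$ be a complete $C^*$-algebra-valued metric space. Suppose that the mappings $F\colon X\times X\rightarrow X$ and $g\colon X\rightarrow X$ satisfy $$d(F(x,y),F(u,v))\preceq a\,d(F(x,y),gx)+b\,d(F(u,v),gu)\quad\text{for any } x,y,u,v\in X,$$ where $a,b\in\mathcal{A}_{+}'$ with $\|a\|+\|b\|<1$. If $F(X\times X)\subseteq g(X)$ and $g(X)$ is complete in $X$, then $F$ and $g$ have a coupled coincidence point. Moreover, if $F$ and $g$ are w-compatible, then they have a unique common coupled fixed point in $X$.
   Context: $\mathcal{A}$ is a unital (complex) $C^*$-algebra with zero element $0_{\mathcal A}$ and unit $1_{\mathcal A}$. An element $a\in\mathcal A$ is positive, written $0_{\mathcal A}\preceq a$, if $a$ is hermitian and its spectrum is contained in $[0,+\infty)$; for hermitian $a,b$, $a\preceq b$ means $0_{\mathcal A}\preceq b-a$. $\mathcal A_+$ is the set of positive elements, $\mathcal A'=\{a\in\mathcal A: ab=ba\ \forall b\in\mathcal A\}$, and $\mathcal A_+'=\mathcal A_+\cap\mathcal A'$. A $C^*$-algebra-valued metric space $(X,\mathcal A,d)$ consists of a nonempty set $X$ and a map $d\colon X\times X\to\mathcal A$ such that for all $x,y,z\in X$: (1) $0_{\mathcal A}\preceq d(x,y)$; (2) $d(x,y)=0_{\mathcal A}$ iff $x=y$; (3) $d(x,y)=d(y,x)$; (4) $d(x,y)\preceq d(x,z)+d(z,y)$. A sequence $\{x_n\}$ converges to $x$ if $\|d(x_n,x)\|\to 0$; it is Cauchy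 if $\|d(x_{n+p},x_n)\|\to 0$ as $n\to\infty$, uniformly in $p\in\mathbb N$. The space is complete if every Cauchy sequence in $X$ converges in $X$; a subset $g(X)$ is complete if every Cauchy sequence in $g(X)$ converges to a point of $g(X)$. We write $gx=g(x)$. For $F\colon X\times X\to X$ and $g\colon X\to X$, a pair $(x,y)\in X\times X$ is a coupled coincidence point of $F$ and $g$ if $F(x,y)=gx$ and $F(y,x)=gy$; it is a common coupled fixed point of $F$ and $g$ if $F(x,y)=gx=x$ and $F(y,x)=gy=y$. $F$ and $g$ are w-compatible if $g(F(x,y))=F(gx,gy)$ whenever $gx=F(x,y)$ and $gy=F(y,x)$. *)

theory Defs
  imports "HOL-Analysis.Analysis"
begin

section \<open>Unital complex C*-algebras\<close>

text \<open>
  The class builds on \<^class>\<open>monoid_mult\<close> rather than on \<^class>\<open>real_normed_algebra_1\<close>, so that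
  the zero algebra (where the unit equals zero) is not excluded.  In every other instance the unit
  has norm one, by the C*-identity.
\<close>

class unital_cstar_algebra = real_normed_algebra + banach + monoid_mult +
  fixes scaleC :: "complex \<Rightarrow> 'a \<Rightarrow> 'a"  (infixr "*\<^sub>C" 75)
    and star :: "'a \<Rightarrow> 'a"
  assumes scaleC_add_right: "c *\<^sub>C (x + y) = c *\<^sub>C x + c *\<^sub>C y"
    and scaleC_add_left: "(c + e) *\<^sub>C x = c *\<^sub>C x + e *\<^sub>C x"
    and scaleC_scaleC: "c *\<^sub>C (e *\<^sub>C x) = (c * e) *\<^sub>C x"
    and scaleC_one: "1 *\<^sub>C x = x"
    and scaleC_of_real: "complex_of_real r *\<^sub>C x = r *\<^sub>R x"
    and mult_scaleC_left: "(c *\<^sub>C x) * y = c *\<^sub>C (x * y)"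
    and mult_scaleC_right: "x * (c *\<^sub>C y) = c *\<^sub>C (x * y)"
    and norm_scaleC: "norm (c *\<^sub>C x) = cmod c * norm x"
    and star_add: "star (x + y) = star x + star y"
    and star_scaleC: "star (c *\<^sub>C x) = cnj c *\<^sub>C star x"
    and star_mult: "star (x * y) = star y * star x"
    and star_star: "star (star x) = x"
    and cstar_identity: "norm (star x * x) = (norm x)\<^sup>2"

definition hermitian :: "'a::unital_cstar_algebra \<Rightarrow> bool" where
  "hermitian a \<longleftrightarrow> star a = a"

definition cstar_spectrum :: "'a::unital_cstar_algebra \<Rightarrow> complex set" where
  "cstar_spectrum a = {c. \<not> (\<exists>b. (a - c *\<^sub>C 1) * b = 1 \<and> b * (a - c *\<^sub>C 1) = 1)}"

definition cstar_positive :: "'a::unital_cstar_algebra \<Rightarrow> bool" where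
  "cstar_positive a \<longleftrightarrow> hermitian a \<and> cstar_spectrum a \<subseteq> complex_of_real ` {0..}"

definition cstar_le :: "'a::unital_cstar_algebra \<Rightarrow> 'a \<Rightarrow> bool"  (infix "\<preceq>" 50) where
  "a \<preceq> b \<longleftrightarrow> hermitian a \<and> hermitian b \<and> cstar_positive (b - a)"

definition commutant :: "'a::unital_cstar_algebra set" where
  "commutant = {a. \<forall>b. a * b = b * a}"

definition positive_commutant :: "'a::unital_cstar_algebra set" where
  "positive_commutant = {a. cstar_positive a} \<inter> commutant"


section \<open>C*-algebra-valued metric spaces\<close>

locale cstar_metric_space =
  fixes X :: "'x set" and d :: "'x \<Rightarrow> 'x \<Rightarrow> 'a::unital_cstar_algebra"
  assumes nonempty: "X \<noteq> {}"
    and nonneg: "\<lbrakk>x \<in> X; y \<in> X\<rbrakk> \<Longrightarrow> 0 \<preceq> d x y"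
    and zero_iff: "\<lbrakk>x \<in> X; y \<in> X\<rbrakk> \<Longrightarrow> d x y = 0 \<longleftrightarrow> x = y"
    and commute: "\<lbrakk>x \<in> X; y \<in> X\<rbrakk> \<Longrightarrow> d x y = d y x"
    and triangle: "\<lbrakk>x \<in> X; y \<in> X; z \<in> X\<rbrakk> \<Longrightarrow> d x y \<preceq> d x z + d z y"

definition cstar_converges ::
    "('x \<Rightarrow> 'x \<Rightarrow> 'a::unital_cstar_algebra) \<Rightarrow> (nat \<Rightarrow> 'x) \<Rightarrow> 'x \<Rightarrow> bool" where
  "cstar_converges d s l \<longleftrightarrow> (\<lambda>n. norm (d (s n) l)) \<longlonglongrightarrow> 0"

definition cstar_Cauchy ::
    "('x \<Rightarrow> 'x \<Rightarrow> 'a::unital_cstar_algebra) \<Rightarrow> (nat \<Rightarrow> 'x) \<Rightarrow> bool" where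
  "cstar_Cauchy d s \<longleftrightarrow>
     uniform_limit UNIV (\<lambda>n p. norm (d (s (n + p)) (s n))) (\<lambda>p. 0) sequentially"

definition cstar_complete ::
    "('x \<Rightarrow> 'x \<Rightarrow> 'a::unital_cstar_algebra) \<Rightarrow> 'x set \<Rightarrow> bool" where
  "cstar_complete d S \<longleftrightarrow>
     (\<forall>s. range s \<subseteq> S \<and> cstar_Cauchy d s \<longrightarrow> (\<exists>l\<in>S. cstar_converges d s l))"


section \<open>Coupled coincidence points and common coupled fixed points\<close>

definition coupled_coincidence_point ::
    "'x set \<Rightarrow> ('x \<times> 'x \<Rightarrow> 'x) \<Rightarrow> ('x \<Rightarrow> 'x) \<Rightarrow> 'x \<times> 'x \<Rightarrow> bool" where
  "coupled_coincidence_point X F g p \<longleftrightarrow>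
     (case p of (x, y) \<Rightarrow> x \<in> X \<and> y \<in> X \<and> F (x, y) = g x \<and> F (y, x) = g y)"

definition common_coupled_fixed_point ::
    "'x set \<Rightarrow> ('x \<times> 'x \<Rightarrow> 'x) \<Rightarrow> ('x \<Rightarrow> 'x) \<Rightarrow> 'x \<times> 'x \<Rightarrow> bool" where
  "common_coupled_fixed_point X F g p \<longleftrightarrow>
     (case p of (x, y) \<Rightarrow> x \<in> X \<and> y \<in> X \<and>
        F (x, y) = g x \<and> g x = x \<and> F (y, x) = g y \<and> g y = y)"

definition w_compatible :: "'x set \<Rightarrow> ('x \<times> 'x \<Rightarrow> 'x) \<Rightarrow> ('x \<Rightarrow> 'x) \<Rightarrow> bool" where
  "w_compatible X F g \<longleftrightarrow>
     (\<forall>x\<in>X. \<forall>y\<in>X. g x = F (x, y) \<and> g y = F (y, x) \<longrightarrow> g (F (x, y)) = F (g x, g y))"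

end

theory Submission
  imports Defs
begin

text \<open>
  If $0 \preceq x \preceq y$ then $\|x\| \le \|y\|$; hence $D(x,y) = \|d(x,y)\|$ is an ordinary
  metric, and the contraction condition turns into a Kannan-type condition with constants
  $\|a\| + \|b\| < 1$.  The second argument of $F$ plays no role in the right-hand side, so the
  diagonal Picard iteration $g x_{n+1} = F(x_n,x_n)$ suffices: $g x_n$ is Cauchy, and its limit
  $g l$ satisfies $F(l,m) = g l$ for every $m$, so that $(l,l)$ is a coupled coincidence point.
  Any two coupled coincidence points have the same image under $g$ in each component, which yields
  the common fixed point and its uniqueness.

  Monotonicity of the norm rests on the fact that the norm of a hermitian element $a$ is bounded
  by its spectral radius.  This is shown without holomorphic calculus, following Rickart: the
  inverse of $1 - (ua)^n$ with $n = 2^k$ is the average of the inverses of $1 - \omega u a$ over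
  the $n$-th roots of unity $\omega$, so these inverses are equicontinuous in $u$, uniformly
  in $k$.  If $1 - ua$ were invertible for all $|u| \le 1/\|a\|$, comparing $|u| = 1/\|a\|$ with a
  slightly smaller radius would contradict $\|a^n\| = \|a\|^n$.
\<close>

section \<open>Algebraic preliminaries\<close>

lemma scaleC_zero_left [simp]: "0 *\<^sub>C (x::'a::unital_cstar_algebra) = 0"
  using scaleC_of_real[of 0 x] by simp

lemma scaleC_minus_left: "(- c) *\<^sub>C (x::'a::unital_cstar_algebra) = - (c *\<^sub>C x)"
  using scaleC_add_left[of "- c" c x] by (simp add: eq_neg_iff_add_eq_0)

lemma scaleC_diff_left: "(c - e) *\<^sub>C (x::'a::unital_cstar_algebra) = c *\<^sub>C x - e *\<^sub>C x"
  using scaleC_add_left[of c "- e" x] by (simp add: scaleC_minus_left)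

lemma scaleC_zero_right [simp]: "c *\<^sub>C (0::'a::unital_cstar_algebra) = 0"
  using scaleC_add_right[of c 0 "0::'a"] by simp

lemma scaleC_minus_right: "c *\<^sub>C (- x) = - (c *\<^sub>C (x::'a::unital_cstar_algebra))"
  using scaleC_add_right[of c "- x" x] by (simp add: eq_neg_iff_add_eq_0)

lemma scaleC_diff_right: "c *\<^sub>C (x - y) = c *\<^sub>C x - c *\<^sub>C (y::'a::unital_cstar_algebra)"
  using scaleC_add_right[of c x "- y"] by (simp add: scaleC_minus_right)

lemma star_one [simp]: "star (1::'a::unital_cstar_algebra) = 1"
  by (metis mult_1_right star_mult star_star)

lemma star_minus: "star (- x) = - star (x::'a::unital_cstar_algebra)"
  using star_scaleC[of "-1" x] by (simp add: scaleC_minus_left scaleC_one)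

lemma star_diff: "star (x - y) = star x - star (y::'a::unital_cstar_algebra)"
  using star_add[of x "- y"] by (simp add: star_minus)

lemma star_scaleR: "star (r *\<^sub>R x) = r *\<^sub>R star (x::'a::unital_cstar_algebra)"
  using star_scaleC[of "of_real r" x] by (simp add: scaleC_of_real)

lemma hermitian_scaleR_one_diff:
  "hermitian x \<Longrightarrow> hermitian (r *\<^sub>R 1 - (x::'a::unital_cstar_algebra))"
  by (simp add: hermitian_def star_diff star_scaleR)

text \<open>The C*-identity at 1 reads ||1|| = ||1||^2, so ||1|| is 0 or 1; the value 0 occurs in
  the zero algebra.\<close>

lemma norm_one_le: "norm (1::'a::unital_cstar_algebra) \<le> 1"
proof -
  have "norm (1::'a) = (norm (1::'a))\<^sup>2"
    using cstar_identity[of "1::'a"] by simp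
  then have "norm (1::'a) * (norm (1::'a) - 1) = 0"
    by (simp add: power2_eq_square algebra_simps)
  then show ?thesis by auto
qed

lemma star_power: "star (x ^ n) = star (x::'a::unital_cstar_algebra) ^ n"
  by (induction n) (simp_all add: star_mult power_commutes)

text \<open>Repeated squaring: powers of a hermitian element are hermitian, so each squaring is an
  instance of the C*-identity.\<close>

lemma norm_hermitian_power:
  fixes x :: "'a::unital_cstar_algebra"
  assumes "hermitian x"
  shows "norm (x ^ 2 ^ k) = norm x ^ 2 ^ k"
proof (induction k)
  case (Suc k)
  have "x ^ 2 ^ Suc k = star (x ^ 2 ^ k) * x ^ 2 ^ k"
    using assms by (simp add: star_power hermitian_def flip: power_add mult_2)
  then show ?case
    using Suc by (simp add: cstar_identity mult.commute flip: power_mult)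
qed simp

section \<open>Invertible elements and elementary facts about the spectrum\<close>

definition inverse_pair :: "'a::unital_cstar_algebra \<Rightarrow> 'a \<Rightarrow> bool" where
  "inverse_pair x y \<longleftrightarrow> x * y = 1 \<and> y * x = 1"

lemma not_in_spectrum_iff:
  "c \<notin> cstar_spectrum a \<longleftrightarrow> (\<exists>b. inverse_pair (a - c *\<^sub>C 1) b)"
  by (simp add: cstar_spectrum_def inverse_pair_def)

lemma inverse_pair_scaleC:
  fixes x y :: "'a::unital_cstar_algebra"
  assumes "inverse_pair x y" "c \<noteq> 0"
  shows "inverse_pair (c *\<^sub>C x) (inverse c *\<^sub>C y)"
  using assms
  by (simp add: inverse_pair_def mult_scaleC_left mult_scaleC_right scaleC_scaleC scaleC_one)

lemma invertible_scaleC_iff: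
  fixes x :: "'a::unital_cstar_algebra"
  assumes "c \<noteq> 0"
  shows "(\<exists>b. inverse_pair (c *\<^sub>C x) b) \<longleftrightarrow> (\<exists>b. inverse_pair x b)"
proof
  assume "\<exists>b. inverse_pair (c *\<^sub>C x) b"
  then obtain b where "inverse_pair (c *\<^sub>C x) b" by blast
  from inverse_pair_scaleC[OF this, of "inverse c"] assms show "\<exists>b. inverse_pair x b"
    by (auto simp: scaleC_scaleC scaleC_one)
qed (use assms inverse_pair_scaleC in blast)

text \<open>In place of summing the Neumann series, right and left inverses arise as fixed points of
  the contractions b -> 1 + w b and b -> 1 + b w; associativity makes them equal.\<close>

lemma invertible_near_one:
  fixes w :: "'a::unital_cstar_algebra"
  assumes "norm w < 1"
  shows "\<exists>b. inverse_pair (1 - w) b"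
proof -
  have "\<exists>!b. 1 + w * b = b"
  proof (rule banach_fix_type)
    show "\<forall>x y. dist (1 + w * x) (1 + w * y) \<le> norm w * dist x y"
      by (simp add: dist_norm norm_mult_ineq flip: right_diff_distrib)
  qed (use assms in auto)
  then obtain b where b: "1 + w * b = b" by blast
  have "\<exists>!b. 1 + b * w = b"
  proof (rule banach_fix_type)
    show "\<forall>x y. dist (1 + x * w) (1 + y * w) \<le> norm w * dist x y"
      by (metis add_diff_cancel_left dist_norm left_diff_distrib mult.commute norm_mult_ineq)
  qed (use assms in auto)
  then obtain c where c: "1 + c * w = c" by blast
  have 1: "(1 - w) * b = 1" using b by (simp add: algebra_simps)
  have 2: "c * (1 - w) = 1" using c by (simp add: algebra_simps)
  have "c = b" by (metis 1 2 mult.assoc mult_1_left mult_1_right)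
  with 1 2 show ?thesis by (auto simp: inverse_pair_def)
qed

lemma invertible_near_scalar:
  fixes x :: "'a::unital_cstar_algebra"
  assumes "norm (c *\<^sub>C 1 - x) < cmod c"
  shows "\<exists>b. inverse_pair x b"
proof -
  have c: "c \<noteq> 0" using assms by auto
  have eq: "x = c *\<^sub>C (1 - inverse c *\<^sub>C (c *\<^sub>C 1 - x))"
    using c by (simp add: scaleC_diff_right scaleC_scaleC scaleC_one)
  have "norm (inverse c *\<^sub>C (c *\<^sub>C 1 - x)) < 1"
    using assms c by (simp add: norm_scaleC norm_divide field_simps)
  from invertible_near_one[OF this] show ?thesis
    by (subst eq) (simp add: invertible_scaleC_iff[OF c])
qed

lemma spectrum_bounded:
  assumes "c \<in> cstar_spectrum (a::'a::unital_cstar_algebra)"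
  shows "cmod c \<le> norm a"
proof (rule ccontr)
  assume "\<not> ?thesis"
  then have "norm ((- c) *\<^sub>C 1 - (a - c *\<^sub>C 1)) < cmod (- c)"
    by (simp add: scaleC_minus_left)
  from invertible_near_scalar[OF this] assms show False
    using not_in_spectrum_iff by blast
qed

text \<open>(r - x) - c = -(x - (r - c)), and the factor -1 does not affect invertibility.\<close>

lemma spectrum_scalar_diff:
  fixes x :: "'a::unital_cstar_algebra"
  assumes "c \<in> cstar_spectrum (r *\<^sub>R 1 - x)"
  shows "of_real r - c \<in> cstar_spectrum x"
proof -
  have "r *\<^sub>R 1 - x - c *\<^sub>C 1 = (-1) *\<^sub>C (x - (of_real r - c) *\<^sub>C 1)"
    by (simp add: scaleC_diff_left scaleC_of_real scaleC_minus_left scaleC_one)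
  then show ?thesis
    using assms invertible_scaleC_iff[of "-1" "x - (of_real r - c) *\<^sub>C 1"]
    by (metis not_in_spectrum_iff neg_eq_iff_add_eq_0 add.right_neutral zero_neq_one)
qed

section \<open>Hermitian elements and the spectral radius\<close>

text \<open>Resolvent identity: R v - R u = R v ((v - u) a) R u. It remains to bound
  \<open>R v\<close> for v near u.\<close>

lemma resolvent_continuous:
  fixes a :: "'a::unital_cstar_algebra"
  assumes R: "\<And>u. u \<in> D \<Longrightarrow> inverse_pair (1 - u *\<^sub>C a) (R u)"
  shows "continuous_on D R"
  unfolding continuous_on_iff
proof (intro ballI allI impI)
  fix u and e :: real
  assume u: "u \<in> D" and e: "0 < e"
  define m where "m = norm a * norm (R u)"
  \<comment> \<open>The first bound gives |v - u| m <= 1/2, which lets ||R v|| be absorbed into 2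
    ||R u||; the second then yields the final estimate e. The summands 1 keep the denominators
    positive.\<close>
  define \<delta> where "\<delta> = min (1 / (2 * (m + 1))) (e / (2 * (m + 1) * (norm (R u) + 1)))"
  have m: "m \<ge> 0" by (simp add: m_def)
  have \<delta>: "\<delta> > 0" using m e by (simp add: \<delta>_def add_nonneg_pos)
  have "dist (R v) (R u) < e" if v: "v \<in> D" and vu: "dist v u < \<delta>" for v
  proof -
    let ?t = "cmod (v - u)"
    have t: "?t < \<delta>" using vu by (simp add: dist_norm)
    have "p * (x - y) * q = p * (x * q) - (p * y) * q" for p q x y :: 'a
      by (simp add: algebra_simps)
    then have "R v - R u = R v * ((1 - u *\<^sub>C a) - (1 - v *\<^sub>C a)) * R u"
      using R[OF u] R[OF v] by (simp only: inverse_pair_def mult_1_left mult_1_right)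
    also have "(1 - u *\<^sub>C a) - (1 - v *\<^sub>C a) = (v - u) *\<^sub>C a"
      by (simp add: scaleC_diff_left)
    finally have "norm (R v - R u) \<le> norm (R v) * norm ((v - u) *\<^sub>C a) * norm (R u)"
      by (simp only: order_trans[OF norm_mult_ineq mult_right_mono[OF norm_mult_ineq norm_ge_zero]])
    then have 1: "norm (R v - R u) \<le> norm (R v) * (?t * m)"
      by (simp add: norm_scaleC m_def mult_ac)
    have "?t * m \<le> ?t * (m + 1)" by (simp add: mult_left_mono)
    also have "\<dots> \<le> 1 / 2"
      using t m by (simp add: \<delta>_def field_simps)
    finally have h: "?t * m \<le> 1 / 2" .
    have "norm (R v) * (?t * m) \<le> norm (R v) * (1 / 2)"
      by (rule mult_left_mono[OF h]) simp
    with 1 have 2: "norm (R v) \<le> 2 * norm (R u)"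
      using norm_triangle_sub[of "R v" "R u"] by linarith
    have "norm (R v - R u) \<le> 2 * norm (R u) * (?t * m)"
      using 1 mult_right_mono[OF 2, of "?t * m"] m by simp
    also have "\<dots> \<le> ?t * (2 * (m + 1) * (norm (R u) + 1))"
    proof -
      have 1: "norm (R u) * m \<le> (norm (R u) + 1) * (m + 1)"
        using m by (intro mult_mono) auto
      have "0 \<le> 2 * ?t" by simp
      from mult_left_mono[OF 1 this] show ?thesis by (simp only: mult_ac)
    qed
    also have "\<dots> < e"
      using t m by (simp add: \<delta>_def pos_less_divide_eq add_nonneg_pos)
    finally show ?thesis by (simp add: dist_norm)
  qed
  with \<delta> show "\<exists>\<delta>>0. \<forall>v\<in>D. dist v u < \<delta> \<longrightarrow> dist (R v) (R u) < e" by blast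
qed

text \<open>The average over roots of unity is built by doubling: the inverse of 1 - B^2 is the mean
  of the inverses of 1 - B and 1 + B. Rotating u preserves the disc and commutes with shrinking by
  s, so the bound e survives every doubling.\<close>

lemma averaged_resolvent:
  fixes a :: "'a::unital_cstar_algebra"
  assumes R: "\<And>u. cmod u \<le> r \<Longrightarrow> inverse_pair (1 - u *\<^sub>C a) (R u)"
    and e: "\<And>u. cmod u \<le> r \<Longrightarrow> norm (R u - R (of_real s * u)) \<le> e"
    and s: "0 \<le> s" "s \<le> 1"
  shows "\<exists>T. \<forall>u. cmod u \<le> r \<longrightarrow>
    inverse_pair (1 - (u ^ 2 ^ k) *\<^sub>C (a ^ 2 ^ k)) (T u) \<and> norm (T u - T (of_real s * u)) \<le> e"
proof (induction k)
  case 0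
  then show ?case using R e by auto
next
  case (Suc k)
  then obtain T where
    T: "\<And>u. cmod u \<le> r \<Longrightarrow> inverse_pair (1 - (u ^ 2 ^ k) *\<^sub>C (a ^ 2 ^ k)) (T u)"
    and Te: "\<And>u. cmod u \<le> r \<Longrightarrow> norm (T u - T (of_real s * u)) \<le> e"
    by blast
  \<comment> \<open>Replacing u by \<omega> u changes the sign of u^(2^k), turning 1 - B into 1 +
    B.\<close>
  define \<omega> where "\<omega> = cis (pi / 2 ^ k)"
  have \<omega>: "\<omega> ^ 2 ^ k = -1"
    unfolding \<omega>_def Complex.DeMoivre by simp
  have norm\<omega>: "cmod (\<omega> * u) = cmod u" for u
    by (simp add: \<omega>_def norm_mult)
  define S where "S u = (1/2) *\<^sub>R (T u + T (\<omega> * u))" for u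
  have "inverse_pair (1 - (u ^ 2 ^ Suc k) *\<^sub>C (a ^ 2 ^ Suc k)) (S u)"
    if u: "cmod u \<le> r" for u
  proof -
    define B where "B = (u ^ 2 ^ k) *\<^sub>C (a ^ 2 ^ k)"
    have P: "inverse_pair (1 - B) (T u)"
      using T[OF u] by (simp add: B_def)
    have Q: "inverse_pair (1 + B) (T (\<omega> * u))"
      using T[of "\<omega> * u"] u norm\<omega>[of u]
      by (simp add: B_def power_mult_distrib \<omega> scaleC_minus_left)
    have BB: "1 - (u ^ 2 ^ Suc k) *\<^sub>C (a ^ 2 ^ Suc k) = 1 - B * B"
      by (simp add: B_def mult_scaleC_left mult_scaleC_right scaleC_scaleC mult_2
          flip: power_add)
    have f1: "1 - B * B = (1 - B) * (1 + B)" and f2: "1 - B * B = (1 + B) * (1 - B)"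
      by (simp_all add: algebra_simps)
    have "T u * (1 - B * B) = 1 + B"
      unfolding f1 using P by (metis inverse_pair_def mult.assoc mult_1_left)
    moreover have "(1 - B * B) * T u = 1 + B"
      unfolding f2 using P by (metis inverse_pair_def mult.assoc mult_1_right)
    moreover have "T (\<omega> * u) * (1 - B * B) = 1 - B"
      unfolding f2 using Q by (metis inverse_pair_def mult.assoc mult_1_left)
    moreover have "(1 - B * B) * T (\<omega> * u) = 1 - B"
      unfolding f1 using Q by (metis inverse_pair_def mult.assoc mult_1_right)
    ultimately show ?thesis
      unfolding BB inverse_pair_def S_def
      by (simp add: distrib_left distrib_right del: left_diff_distrib right_diff_distrib flip: scaleR_2)
  qed
  moreover have "norm (S u - S (of_real s * u)) \<le> e" if u: "cmod u \<le> r" for u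
  proof -
    have "S u - S (of_real s * u) =
        (1/2) *\<^sub>R ((T u - T (of_real s * u)) + (T (\<omega> * u) - T (of_real s * (\<omega> * u))))"
      by (simp add: S_def algebra_simps)
    also have "norm \<dots> \<le> (1/2) * (norm (T u - T (of_real s * u))
        + norm (T (\<omega> * u) - T (of_real s * (\<omega> * u))))"
      by (simp add: norm_triangle_ineq)
    also have "\<dots> \<le> e"
      using Te[OF u] Te[of "\<omega> * u"] u norm\<omega>[of u] by simp
    finally show ?thesis .
  qed
  ultimately show ?case by blast
qed

text \<open>In the zero algebra the spectrum of 0 is empty, hence the assumption that a is
  nonzero.\<close>

lemma hermitian_spectral_radius:
  fixes a :: "'a::unital_cstar_algebra"
  assumes herm: "hermitian a" and "a \<noteq> 0"
  shows "\<exists>c\<in>cstar_spectrum a. norm a \<le> cmod c"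
proof (rule ccontr)
  assume neg: "\<not> ?thesis"
  define r where "r = 1 / norm a"
  have na: "norm a > 0" using assms by simp
  have r: "r > 0" using na by (simp add: r_def)
  have "\<exists>b. inverse_pair (1 - u *\<^sub>C a) b" if u: "cmod u \<le> r" for u
  proof (cases "u = 0")
    case True
    then show ?thesis by (auto simp: inverse_pair_def)
  next
    case False
    have "norm a \<le> cmod (inverse u)"
      using u na False by (simp add: r_def norm_divide field_simps)
    then have "inverse u \<notin> cstar_spectrum a" using neg by blast
    moreover have "1 - u *\<^sub>C a = (- u) *\<^sub>C (a - inverse u *\<^sub>C 1)"
      using False by (simp add: scaleC_diff_right scaleC_scaleC scaleC_minus_left scaleC_one)
    ultimately show ?thesis
      using invertible_scaleC_iff[of "- u" "a - inverse u *\<^sub>C 1"] False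
      by (simp add: not_in_spectrum_iff)
  qed
  then obtain R where R: "\<And>u. cmod u \<le> r \<Longrightarrow> inverse_pair (1 - u *\<^sub>C a) (R u)"
    by metis
  have "uniformly_continuous_on (cball 0 r) R"
    by (intro compact_uniformly_continuous resolvent_continuous[where a = a] R) auto
  then obtain \<delta> where \<delta>: "\<delta> > 0" and unif:
    "\<And>u v. cmod u \<le> r \<Longrightarrow> cmod v \<le> r \<Longrightarrow> dist v u < \<delta> \<Longrightarrow> dist (R v) (R u) < 1 / 4"
    unfolding uniformly_continuous_on_def
    by (metis dist_0_norm mem_cball zero_less_divide_1_iff zero_less_numeral)
  \<comment> \<open>Shrinking by s moves points of the disc by at most \<delta>/2; the maximum with
    0 keeps s in [0,1).\<close>
  define s where "s = max 0 (1 - \<delta> / (2 * r))"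
  have s: "0 \<le> s" "s < 1" using \<delta> r by (auto simp: s_def)
  have sR: "norm (R u - R (of_real s * u)) \<le> 1 / 4" if u: "cmod u \<le> r" for u
  proof -
    have "cmod (of_real s * u) \<le> r"
      using s u mult_left_le_one_le[of "cmod u" s] by (simp add: norm_mult)
    moreover have "dist u (of_real s * u) < \<delta>"
    proof -
      have "u - of_real s * u = of_real (1 - s) * u" by (simp add: algebra_simps)
      then have "dist u (of_real s * u) = (1 - s) * cmod u"
        using s by (simp add: dist_norm norm_mult flip: of_real_diff)
      also have "\<dots> \<le> (\<delta> / (2 * r)) * r"
        using s u r \<delta> by (intro mult_mono) (auto simp: s_def)
      also have "\<dots> < \<delta>" using r \<delta> by simp
      finally show ?thesis .
    qed
    ultimately show ?thesis using unif u by (force simp: dist_norm)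
  qed
  \<comment> \<open>Since N <= 2^N, also s^(2^N) < 1/8. The exponent may depend on s because the
    bound 1/4 for \<open>T\<close> does not depend on N.\<close>
  obtain N where N: "s ^ N < 1 / 8"
    using real_arch_pow_inv[of "1/8" s] s by auto
  define s' where "s' = s ^ 2 ^ N"
  have s': "0 \<le> s'" "s' < 1 / 8"
    using N s power_decreasing[of N "2 ^ N" s] by (auto simp: s'_def less_imp_le)
  define u :: complex where "u = of_real r"
  define A where "A = (u ^ 2 ^ N) *\<^sub>C (a ^ 2 ^ N)"
  have u: "cmod u \<le> r" using r by (simp add: u_def)
  have nA: "norm A = 1"
  proof -
    have "norm A = (r * norm a) ^ 2 ^ N"
      using r by (simp add: A_def norm_scaleC norm_power norm_hermitian_power[OF herm] u_def
          power_mult_distrib)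
    then show ?thesis using na by (simp add: r_def)
  qed
  obtain T where
    T: "\<And>u. cmod u \<le> r \<Longrightarrow> inverse_pair (1 - (u ^ 2 ^ N) *\<^sub>C (a ^ 2 ^ N)) (T u)"
    and Te: "\<And>u. cmod u \<le> r \<Longrightarrow> norm (T u - T (of_real s * u)) \<le> 1 / 4"
    using averaged_resolvent[of r a R s "1/4" N] R sR s by auto
  define t where "t = T u"
  define v where "v = T (of_real s * u)"
  have "(1 - A) * t = 1"
    using T[OF u] by (simp add: A_def t_def inverse_pair_def)
  \<comment> \<open>Two facts collide: \<open>v\<close>, the inverse of 1 - s' A, is within 1/7 of
    1, so \<open>t\<close>, the inverse of 1 - A, is within 1/4 + 1/7 < 1/2 of 1.\<close>
  then have tA: "A * t = t - 1" by (simp add: algebra_simps)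
  have "cmod (of_real s * u) \<le> r"
    using s u mult_left_le_one_le[of "cmod u" s] by (simp add: norm_mult)
  from T[OF this] have "(1 - s' *\<^sub>R A) * v = 1"
    by (simp add: A_def v_def inverse_pair_def power_mult_distrib s'_def scaleC_scaleC
        flip: scaleC_of_real)
  then have "v - 1 = s' *\<^sub>R (A * v)" by (simp add: algebra_simps)
  then have "norm (v - 1) \<le> s' * (norm A * norm v)"
    using s' by (simp add: mult_left_mono norm_mult_ineq)
  also have "\<dots> \<le> 1 / 8 * norm v"
    using s' nA mult_right_mono[of s' "1 / 8" "norm v"] by simp
  finally have v: "norm (v - 1) \<le> 1 / 8 * norm v" .
  have "norm v \<le> norm (v - 1) + 1"
    using norm_triangle_sub[of v 1] norm_one_le[where 'a = 'a] by linarith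
  with v have "norm (v - 1) \<le> 1 / 7" by linarith
  moreover have "norm (t - v) \<le> 1 / 4"
    using Te[OF u] by (simp add: t_def v_def)
  moreover have "norm (t - 1) \<le> norm (t - v) + norm (v - 1)"
    using norm_triangle_ineq[of "t - v" "v - 1"] by simp
  ultimately have small: "norm (t - 1) < 1 / 2" by linarith
  \<comment> \<open>Hence 1 = ||A|| <= 2 ||t - 1|| < 1, a contradiction.\<close>
  have "A = (t - 1) - A * (t - 1)"
    using tA by (simp add: right_diff_distrib)
  then have "norm A \<le> norm (t - 1) + norm (A * (t - 1))"
    by (metis norm_triangle_ineq4)
  also have "norm (A * (t - 1)) \<le> norm (t - 1)"
    using norm_mult_ineq[of A "t - 1"] nA by simp
  finally show False using small nA by simp
qed

section \<open>Monotonicity of the norm on positive elements\<close>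

text \<open>The spectrum of z lies in [0, ||z||], hence so does that of ||z|| - z, and a nonzero
  hermitian element has norm at most the modulus of some spectral value.\<close>

lemma cstar_positive_norm_diff_le:
  fixes z :: "'a::unital_cstar_algebra"
  assumes "cstar_positive z"
  shows "norm (norm z *\<^sub>R 1 - z) \<le> norm z"
proof (cases "norm z *\<^sub>R 1 - z = 0")
  case False
  moreover have "hermitian (norm z *\<^sub>R 1 - z)"
    using assms by (simp add: cstar_positive_def hermitian_scaleR_one_diff)
  ultimately obtain c where c: "c \<in> cstar_spectrum (norm z *\<^sub>R 1 - z)"
    and le: "norm (norm z *\<^sub>R 1 - z) \<le> cmod c"
    using hermitian_spectral_radius by blast
  have *: "of_real (norm z) - c \<in> cstar_spectrum z"
    using spectrum_scalar_diff[OF c] .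
  then obtain t where t: "of_real (norm z) - c = of_real t" "0 \<le> t"
    using assms by (auto simp: cstar_positive_def)
  have "t \<le> norm z" using spectrum_bounded[OF *] t by simp
  moreover have "c = of_real (norm z - t)" using t(1) by (simp add: algebra_simps)
  then have "cmod c = \<bar>norm z - t\<bar>" by (metis norm_of_real)
  ultimately show ?thesis using le t by linarith
qed simp

lemma cstar_positive_norm_in_spectrum:
  fixes x :: "'a::unital_cstar_algebra"
  assumes "cstar_positive x" "x \<noteq> 0"
  shows "of_real (norm x) \<in> cstar_spectrum x"
proof -
  obtain c where c: "c \<in> cstar_spectrum x" "norm x \<le> cmod c"
    using assms hermitian_spectral_radius by (auto simp: cstar_positive_def)
  then obtain t where "c = of_real t" "0 \<le> t"
    using assms by (auto simp: cstar_positive_def)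
  then show ?thesis using c spectrum_bounded[OF c(1)] by auto
qed

text \<open>If ||y|| < ||x||, then x - ||x|| is closer to the scalar -(||z|| + ||x||), with z = y -
  x, than the modulus of that scalar. So it is invertible, although ||x|| is in the spectrum of
  x.\<close>

lemma cstar_le_norm_mono:
  fixes x y :: "'a::unital_cstar_algebra"
  assumes "0 \<preceq> x" "x \<preceq> y"
  shows "norm x \<le> norm y"
proof (rule ccontr)
  assume neg: "\<not> ?thesis"
  define z where "z = y - x"
  have x: "cstar_positive x" and z: "cstar_positive z"
    using assms by (auto simp: cstar_le_def z_def)
  have "x \<noteq> 0" using neg by auto
  then have spec: "of_real (norm x) \<in> cstar_spectrum x"
    using cstar_positive_norm_in_spectrum x by blast
  define c where "c = - complex_of_real (norm z + norm x)"
  have "c *\<^sub>C 1 - (x - of_real (norm x) *\<^sub>C 1) = - (norm z *\<^sub>R 1 - z) - y"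
    by (simp add: c_def z_def scaleC_minus_left scaleC_of_real scaleR_add_left
        del: of_real_add)
  then have "norm (c *\<^sub>C 1 - (x - of_real (norm x) *\<^sub>C 1)) \<le> norm (norm z *\<^sub>R 1 - z) + norm y"
    by (metis norm_minus_cancel norm_triangle_ineq4)
  also have "\<dots> < norm z + norm x"
    using cstar_positive_norm_diff_le[OF z] neg by linarith
  also have "\<dots> = cmod c"
    unfolding c_def norm_minus_cancel norm_of_real by simp
  finally show False
    using invertible_near_scalar spec not_in_spectrum_iff by blast
qed

section \<open>Coupled coincidence points\<close>

lemma (in cstar_metric_space) norm_triangle:
  assumes "x \<in> X" "y \<in> X" "z \<in> X"
  shows "norm (d x y) \<le> norm (d x z) + norm (d z y)"
  using cstar_le_norm_mono[OF nonneg triangle] assms norm_triangle_ineq order_trans by blast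

lemma (in cstar_metric_space) geometric_Cauchy:
  assumes s: "\<And>n. s n \<in> X" and q: "0 \<le> q" "q < 1"
    and step: "\<And>n. norm (d (s (Suc (Suc n))) (s (Suc n))) \<le> q * norm (d (s (Suc n)) (s n))"
  shows "cstar_Cauchy d s"
proof -
  define c where "c = norm (d (s 1) (s 0))"
  have geo: "norm (d (s (Suc n)) (s n)) \<le> c * q ^ n" for n
  proof (induction n)
    case (Suc n)
    have "q * norm (d (s (Suc n)) (s n)) \<le> q * (c * q ^ n)"
      using Suc q by (intro mult_left_mono)
    with step[of n] show ?case by (simp add: mult_ac)
  qed (simp add: c_def)
  \<comment> \<open>The bound is independent of p, as uniformity in \<open>cstar_Cauchy\<close>
    demands. The induction peels off the first step, so n must vary.\<close>
  have bound: "norm (d (s (n + p)) (s n)) \<le> c * q ^ n / (1 - q)" for n p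
  proof (induction p arbitrary: n)
    case 0
    have "d (s n) (s n) = 0" using zero_iff s by blast
    then show ?case using q by (simp add: c_def)
  next
    case (Suc p)
    have "norm (d (s (n + Suc p)) (s n))
        \<le> norm (d (s (Suc n + p)) (s (Suc n))) + norm (d (s (Suc n)) (s n))"
      using norm_triangle[OF s s s] by simp
    also have "\<dots> \<le> c * q ^ Suc n / (1 - q) + c * q ^ n"
      using Suc[of "Suc n"] geo[of n] by linarith
    also have "\<dots> = c * q ^ n / (1 - q)"
      using q by (simp add: field_simps)
    finally show ?case .
  qed
  have "(\<lambda>n. q ^ n) \<longlonglongrightarrow> 0" using q by (intro LIMSEQ_power_zero) simp
  then have lim: "(\<lambda>n. c * q ^ n / (1 - q)) \<longlonglongrightarrow> 0"
    using tendsto_mult_right_zero[of "\<lambda>n. q ^ n" sequentially "c / (1 - q)"] by simp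
  show ?thesis
    unfolding cstar_Cauchy_def uniform_limit_iff
  proof (intro allI impI)
    fix e :: real assume "0 < e"
    with lim have "\<forall>\<^sub>F n in sequentially. c * q ^ n / (1 - q) < e"
      by (simp add: order_tendstoD(2))
    then show "\<forall>\<^sub>F n in sequentially. \<forall>p\<in>UNIV. dist (norm (d (s (n + p)) (s n))) 0 < e"
      by eventually_elim (use bound in \<open>auto intro: le_less_trans\<close>)
  qed
qed

text \<open>The hypotheses after passing to norms, with \<alpha> and \<beta> in the roles of ||a||
  and ||b||.\<close>

locale kannan_coupled = cstar_metric_space X d
  for X :: "'x set" and d :: "'x \<Rightarrow> 'x \<Rightarrow> 'a::unital_cstar_algebra" +
  fixes F :: "'x \<times> 'x \<Rightarrow> 'x" and g :: "'x \<Rightarrow> 'x" and \<alpha> \<beta> :: real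
  assumes F_in: "\<lbrakk>x \<in> X; y \<in> X\<rbrakk> \<Longrightarrow> F (x, y) \<in> X"
    and g_in: "x \<in> X \<Longrightarrow> g x \<in> X"
    and \<alpha>\<beta>: "0 \<le> \<alpha>" "0 \<le> \<beta>" "\<alpha> + \<beta> < 1"
    and contr: "\<lbrakk>x \<in> X; y \<in> X; u \<in> X; v \<in> X\<rbrakk> \<Longrightarrow>
      norm (d (F (x, y)) (F (u, v)))
        \<le> \<alpha> * norm (d (F (x, y)) (g x)) + \<beta> * norm (d (F (u, v)) (g u))"
    and F_range: "F ` (X \<times> X) \<subseteq> g ` X"
    and complete_range: "cstar_complete d (g ` X)"
begin

lemma d_self: "x \<in> X \<Longrightarrow> d x x = 0"
  using zero_iff by blast

text \<open>Both distances on the right of the contraction condition vanish. Nothing is asked of the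
  second components y and v beyond membership in X.\<close>

lemma coincidence_values_eq:
  assumes "x \<in> X" "y \<in> X" "u \<in> X" "v \<in> X" "F (x, y) = g x" "F (u, v) = g u"
  shows "g x = g u"
  using contr[of x y u v] assms d_self zero_iff g_in by simp

lemma orbit_limit:
  assumes x_in: "\<And>n. x n \<in> X"
    and orbit: "\<And>n. g (x (Suc n)) = F (x n, x n)"
  shows "\<exists>l\<in>X. \<forall>m\<in>X. F (l, m) = g l"
proof -
  let ?s = "\<lambda>n. g (x n)"
  have sX: "?s n \<in> X" for n using x_in g_in by blast
  have "cstar_Cauchy d ?s"
  proof (rule geometric_Cauchy)
    \<comment> \<open>Applied to consecutive terms, the condition has the new distance on both
      sides; solving for it gives this ratio, below 1 because \<alpha> + \<beta> < 1.\<close>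
    show "0 \<le> \<beta> / (1 - \<alpha>)" "\<beta> / (1 - \<alpha>) < 1" using \<alpha>\<beta> by auto
    fix n
    have "norm (d (?s (Suc (Suc n))) (?s (Suc n)))
        \<le> \<alpha> * norm (d (?s (Suc (Suc n))) (?s (Suc n))) + \<beta> * norm (d (?s (Suc n)) (?s n))"
      using contr[OF x_in x_in x_in x_in, of "Suc n" "Suc n" n n] by (simp only: orbit)
    then show "norm (d (?s (Suc (Suc n))) (?s (Suc n)))
        \<le> \<beta> / (1 - \<alpha>) * norm (d (?s (Suc n)) (?s n))"
      using \<alpha>\<beta> by (simp add: field_simps)
  qed (use sX in auto)
  moreover have "range ?s \<subseteq> g ` X" using x_in by auto
  ultimately obtain l where l: "l \<in> X" and conv: "(\<lambda>n. norm (d (?s n) (g l))) \<longlonglongrightarrow> 0"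
    using complete_range unfolding cstar_complete_def cstar_converges_def by blast
  have "F (l, m) = g l" if m: "m \<in> X" for m
  proof -
    let ?D = "norm (d (F (l, m)) (g l))"
    \<comment> \<open>The detour through g(x (n+1)) = F(x n, x n) brings in \<beta>
      \<open>?D\<close>, which is moved to the left; the remaining terms tend to 0.\<close>
    have bound: "(1 - \<beta>) * ?D \<le> (1 + \<alpha>) * norm (d (?s (Suc n)) (g l)) + \<alpha> * norm (d (?s n) (g l))"
      for n
    proof -
      have "?D \<le> norm (d (F (l, m)) (?s (Suc n))) + norm (d (?s (Suc n)) (g l))"
        by (rule norm_triangle[OF F_in[OF l m] g_in[OF l] sX])
      moreover have "d (F (l, m)) (?s (Suc n)) = d (F (x n, x n)) (F (l, m))"
        using commute[OF F_in[OF l m] sX, of "Suc n"] by (simp add: orbit)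
      moreover have "norm (d (F (x n, x n)) (F (l, m)))
          \<le> \<alpha> * norm (d (?s (Suc n)) (?s n)) + \<beta> * ?D"
        using contr[OF x_in x_in l m, of n n] by (simp add: orbit)
      moreover have "norm (d (?s (Suc n)) (?s n))
          \<le> norm (d (?s (Suc n)) (g l)) + norm (d (?s n) (g l))"
        using norm_triangle[OF sX sX g_in[OF l], of "Suc n" n] commute[OF g_in[OF l] sX]
        by simp
      then have "\<alpha> * norm (d (?s (Suc n)) (?s n))
          \<le> \<alpha> * norm (d (?s (Suc n)) (g l)) + \<alpha> * norm (d (?s n) (g l))"
        using \<alpha>\<beta> mult_left_mono by (fastforce simp flip: distrib_left)
      ultimately show ?thesis by (simp add: algebra_simps)
    qed
    have "(\<lambda>n. (1 + \<alpha>) * norm (d (?s (Suc n)) (g l)) + \<alpha> * norm (d (?s n) (g l))) \<longlonglongrightarrow> 0"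
      using tendsto_add[OF tendsto_mult_right_zero[OF LIMSEQ_Suc[OF conv], of "1 + \<alpha>"]
          tendsto_mult_right_zero[OF conv, of \<alpha>]] by simp
    then have "(1 - \<beta>) * ?D \<le> 0"
      using bound by (intro LIMSEQ_le_const) auto
    then have "?D = 0" using \<alpha>\<beta> by (simp add: mult_le_0_iff)
    then show ?thesis using zero_iff F_in g_in l m by simp
  qed
  with l show ?thesis by blast
qed

lemma coincidence_exists: "\<exists>p. coupled_coincidence_point X F g p"
proof -
  obtain x0 where x0: "x0 \<in> X" using nonempty by blast
  have "\<forall>x\<in>X. \<exists>z\<in>X. g z = F (x, x)"
  proof
    fix x assume "x \<in> X"
    then have "F (x, x) \<in> g ` X" using F_range by blast
    then show "\<exists>z\<in>X. g z = F (x, x)" by auto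
  qed
  \<comment> \<open>\<open>h\<close> picks a g-preimage of F(x, x), so the iterates of
    \<open>h\<close> form the required orbit.\<close>
  then obtain h where h: "\<And>x. x \<in> X \<Longrightarrow> h x \<in> X \<and> g (h x) = F (x, x)"
    by metis
  have w: "(h ^^ n) x0 \<in> X" for n
    by (induction n) (simp_all add: x0 h)
  then have "g ((h ^^ Suc n) x0) = F ((h ^^ n) x0, (h ^^ n) x0)" for n
    by (simp add: h)
  with w obtain l where "l \<in> X" "\<forall>m\<in>X. F (l, m) = g l"
    using orbit_limit[of "\<lambda>n. (h ^^ n) x0"] by blast
  then have "coupled_coincidence_point X F g (l, l)"
    by (simp add: coupled_coincidence_point_def)
  then show ?thesis ..
qed

lemma common_fixed_point_unique_exists:
  assumes compat: "w_compatible X F g"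
  shows "\<exists>!p. common_coupled_fixed_point X F g p"
proof -
  obtain x y where xy: "x \<in> X" "y \<in> X" "F (x, y) = g x" "F (y, x) = g y"
    using coincidence_exists by (auto simp: coupled_coincidence_point_def)
  \<comment> \<open>By w-compatibility (g x, g y) is again a coincidence point; comparing its values
    with those of (x, y) gives g(g x) = g x and g(g y) = g y.\<close>
  have g2: "F (g x, g y) = g (g x)" "F (g y, g x) = g (g y)"
    using compat xy unfolding w_compatible_def by metis+
  have "g (g x) = g x" "g (g y) = g y"
    using coincidence_values_eq xy g2 g_in by metis+
  then have "common_coupled_fixed_point X F g (g x, g y)"
    using xy g2 g_in by (simp add: common_coupled_fixed_point_def)
  \<comment> \<open>The values of g agree in each component, the second via the swapped pairs, and
    at a common fixed point they are the components themselves.\<close>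
  moreover have "p = q"
    if "common_coupled_fixed_point X F g p" "common_coupled_fixed_point X F g q" for p q
    using that coincidence_values_eq unfolding common_coupled_fixed_point_def
    by (smt (verit) case_prod_beta prod.collapse)
  ultimately show ?thesis by blast
qed

end

theorem theorem2p2:
  fixes X :: "'x set"
    and d :: "'x \<Rightarrow> 'x \<Rightarrow> 'a::unital_cstar_algebra"
    and F :: "'x \<times> 'x \<Rightarrow> 'x"
    and g :: "'x \<Rightarrow> 'x"
    and a b :: 'a
  assumes "cstar_metric_space X d"
    and "cstar_complete d X"
    and "F \<in> X \<times> X \<rightarrow> X"
    and "g \<in> X \<rightarrow> X"
    and "a \<in> positive_commutant"
    and "b \<in> positive_commutant"
    and "norm a + norm b < 1"
    and "\<And>x y u v. \<lbrakk>x \<in> X; y \<in> X; u \<in> X; v \<in> X\<rbrakk> \<Longrightarrow>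
           d (F (x, y)) (F (u, v)) \<preceq> a * d (F (x, y)) (g x) + b * d (F (u, v)) (g u)"
    and "F ` (X \<times> X) \<subseteq> g ` X"
    and "cstar_complete d (g ` X)"
  shows "(\<exists>p. coupled_coincidence_point X F g p) \<and>
         (w_compatible X F g \<longrightarrow> (\<exists>!p. common_coupled_fixed_point X F g p))"
proof -
  interpret cstar_metric_space X d by fact
  have F_in: "F (x, y) \<in> X" if "x \<in> X" "y \<in> X" for x y
    using assms(3) that by auto
  have "kannan_coupled X d F g (norm a) (norm b)"
  proof unfold_locales
    fix x y u v assume X: "x \<in> X" "y \<in> X" "u \<in> X" "v \<in> X"
    \<comment> \<open>Monotonicity of the norm, then submultiplicativity, turns the order condition
      into its real form.\<close>
    have "norm (d (F (x, y)) (F (u, v)))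
        \<le> norm (a * d (F (x, y)) (g x) + b * d (F (u, v)) (g u))"
      using cstar_le_norm_mono[OF nonneg assms(8)] F_in X by blast
    also have "\<dots> \<le> norm a * norm (d (F (x, y)) (g x)) + norm b * norm (d (F (u, v)) (g u))"
      by (intro order_trans[OF norm_triangle_ineq] add_mono norm_mult_ineq)
    finally show "norm (d (F (x, y)) (F (u, v)))
        \<le> norm a * norm (d (F (x, y)) (g x)) + norm b * norm (d (F (u, v)) (g u))" .
  qed (use assms F_in in auto)
  then interpret kannan_coupled X d F g "norm a" "norm b" .
  show ?thesis
    using coincidence_exists common_fixed_point_unique_exists by blast
qed

end
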